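(* Suppose that $f\in\mathcal{H}(\mathbb{B}^n)$ is such that $\|f\|_{0,\alpha}=1$ and $\det f'(0)=\lambda\in(0,1]$. Then for any $z$ with $|z|\le \frac{a_0+m(\lambda)}{1+a_0m(\lambda)}$, $$|\det f'(z)|\ \ge\ \mathrm{Re}\big(\det f'(z)\big)\ \ge\ \frac{\lambda(m(\lambda)-|z|)}{m(\lambda)\,(1-m(\lambda)|z|)^{\alpha(n+1)+1}},$$ where $m(\lambda)$ is the unique real root of the equation $\varphi(x)=\lambda$ in the interval $[0,a_0]$. Moreover, for any $z$ with $|z|\le \frac{a_0-m(\lambda)}{1-a_0m(\lambda)}$, $$|\det f'(z)|\ \le\ \frac{\lambda(m(\lambda)+|z|)}{m(\lambda)\,(1+m(\lambda)|z|)^{\alpha(n+1)+1}}.$$ Both of these estimates (the first displayed chain of inequalities and the second displayed inequality) are sharp.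
   Context: Here $n\ge1$ is an integer and $\alpha>0$. $\mathbb{B}^n=\{z\in\mathbb{C}^n: |z|<1\}$ is the open unit ball for the Euclidean norm $|z|=\big(\sum_{k=1}^n|z_k|^2\big)^{1/2}$. $\mathcal{H}(\mathbb{B}^n)$ is the class of all holomorphic maps $f=(f_1,\ldots,f_n):\mathbb{B}^n\to\mathbb{C}^n$, and $f'(z)=\big(\partial f_i/\partial z_j(z)\big)_{n\times n}$ is the complex Jacobian matrix. The semi-norm $\|f\|_{0,\alpha}$ is $$\|f\|_{0,\alpha}=\sup_{z\in\mathbb{B}^n}\Big\{(1-|z|^2)^{\frac{\alpha(n+1)}{2n}}\,|\det f'(z)|^{\frac1n}\Big\}.$$ For $x\in[0,1]$, $$\varphi(x)=x(1-x^2)^{\frac{\alpha(n+1)}{2}}\sqrt{\alpha(n+1)+1}\,\left[\frac{\alpha(n+1)+1}{\alpha(n+1)}\right]^{\frac{\alpha(n+1)}{2}},\qquad a_0=\frac{1}{\sqrt{\alpha(n+1)+1}}.$$ The function $\varphi$ is increasing on $[0,a_0]$, decreasing on $[a_0,1]$, and $\varphi(a_0)=1$. *)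

theory Defs
  imports "HOL-Analysis.Analysis"
begin

text \<open>Holomorphy of maps between complex coordinate spaces: Frechet differentiability at every
  point, with a complex-linear derivative (a \<^const>\<open>has_derivative\<close> derivative is only
  real-linear in general). The set is meant to be open.\<close>

definition holomorphic_map_on ::
  "(complex^'n \<Rightarrow> complex^'m) \<Rightarrow> (complex^'n) set \<Rightarrow> bool" where
  "holomorphic_map_on f S \<longleftrightarrow>
     (\<forall>z\<in>S. \<exists>D. (f has_derivative D) (at z within S) \<and> (\<forall>c v. D (c *s v) = c *s D v))"

definition complex_jacobian ::
  "(complex^'n \<Rightarrow> complex^'m) \<Rightarrow> complex^'n \<Rightarrow> complex^'n^'m" where
  "complex_jacobian f z =
     (\<chi> i j. deriv (\<lambda>w. f (\<chi> k. if k = j then w else z $ k) $ i) (z $ j))"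

text \<open>The supremum is taken in the extended reals, so that an unbounded \<open>f\<close> has
  semi-norm \<open>\<infinity>\<close> and the condition that the semi-norm is \<open>1\<close> includes
  finiteness.\<close>

definition bloch_seminorm :: "real \<Rightarrow> (complex^'n \<Rightarrow> complex^'n) \<Rightarrow> ereal" where
  "bloch_seminorm \<alpha> f =
     (SUP z\<in>ball 0 1. ereal
        ((1 - (norm z)\<^sup>2) powr (\<alpha> * (real CARD('n) + 1) / (2 * real CARD('n))) *
         cmod (det (complex_jacobian f z)) powr (1 / real CARD('n))))"

definition bloch_phi :: "real \<Rightarrow> nat \<Rightarrow> real \<Rightarrow> real" where
  "bloch_phi \<alpha> n x =
     x * (1 - x\<^sup>2) powr (\<alpha> * (real n + 1) / 2) * sqrt (\<alpha> * (real n + 1) + 1) *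
     ((\<alpha> * (real n + 1) + 1) / (\<alpha> * (real n + 1))) powr (\<alpha> * (real n + 1) / 2)"

definition bloch_a0 :: "real \<Rightarrow> nat \<Rightarrow> real" where
  "bloch_a0 \<alpha> n = 1 / sqrt (\<alpha> * (real n + 1) + 1)"

definition bloch_m :: "real \<Rightarrow> nat \<Rightarrow> real \<Rightarrow> real" where
  "bloch_m \<alpha> n lam = (THE x. x \<in> {0..bloch_a0 \<alpha> n} \<and> bloch_phi \<alpha> n x = lam)"

definition bloch_class :: "real \<Rightarrow> real \<Rightarrow> (complex^'n \<Rightarrow> complex^'n) set" where
  "bloch_class \<alpha> lam =
     {f. holomorphic_map_on f (ball 0 1) \<and> bloch_seminorm \<alpha> f = 1 \<and>
         det (complex_jacobian f 0) = complex_of_real lam}"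

end

theory Submission
  imports Defs "HOL-Complex_Analysis.Complex_Analysis"
begin

text \<open>Put \<open>b = \<alpha> (n + 1)\<close>. On every complex line through the origin the Jacobian determinant is a
  holomorphic function \<open>g\<close> of the unit disc with \<open>(1 - |\<zeta>|\<^sup>2)\<^bsup>b/2\<^esup> |g \<zeta>| \<le> 1\<close>, so the estimates
  are statements about one complex variable. With the involution \<open>T w = (m - w) / (1 - m w)\<close>, the
  function \<open>h w = g (T w) (m / \<lambda>) ((1 - m\<^sup>2) / (1 - m w))\<^bsup>b\<^esup>\<close> fixes \<open>m\<close>, and the growth condition on
  \<open>g\<close> is exactly \<open>|h| \<le> a\<^sub>0\<close> on the circle of radius \<open>a\<^sub>0\<close>. The Schwarz--Pick inequality on that disc
  gives \<open>Re (h w) \<ge> w\<close> for real \<open>w \<le> m\<close> and \<open>|h w| \<le> w\<close> for \<open>w \<ge> m\<close>, which are the two bounds. Equality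
  holds for \<open>h w = w\<close>, realised in the ball by integrating the corresponding \<open>g\<close> in one
  coordinate and keeping the other coordinates.\<close>

section \<open>Disc automorphisms and the Schwarz--Pick inequality\<close>

text \<open>The automorphism of the unit disc that exchanges 0 and \<open>p\<close>. The sign
  \<open>p - z\<close> makes it its own inverse, so one function serves for both directions of the
  change of variable.\<close>

definition disc_inv :: "real \<Rightarrow> complex \<Rightarrow> complex" where
  "disc_inv p z = (of_real p - z) / (1 - of_real p * z)"

lemma disc_inv_denom_nz:
  assumes "\<bar>p\<bar> < 1" "cmod z \<le> 1"
  shows "1 - of_real p * z \<noteq> 0"
proof
  assume "1 - of_real p * z = 0"
  then have "cmod (of_real p * z) = 1" by simp
  moreover have "cmod (of_real p * z) \<le> \<bar>p\<bar> * 1"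
    unfolding norm_mult norm_of_real using assms by (intro mult_left_mono) auto
  ultimately show False using assms by linarith
qed

text \<open>Expansion in real and imaginary parts. This denominator-free identity carries all later
  statements about the modulus of \<open>disc_inv\<close>.\<close>

lemma norm_disc_inv_numerator:
  "(cmod (of_real p - z))\<^sup>2 = (cmod (1 - of_real p * z))\<^sup>2 - (1 - p\<^sup>2) * (1 - (cmod z)\<^sup>2)"
  unfolding cmod_power2 by (simp add: power2_eq_square algebra_simps)

lemma one_minus_norm_disc_inv:
  assumes "\<bar>p\<bar> < 1" "cmod z \<le> 1"
  shows "1 - (cmod (disc_inv p z))\<^sup>2 = (1 - p\<^sup>2) * (1 - (cmod z)\<^sup>2) / (cmod (1 - of_real p * z))\<^sup>2"
  using disc_inv_denom_nz[OF assms]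
  by (simp add: disc_inv_def norm_divide power_divide norm_disc_inv_numerator field_simps)

lemma norm_disc_inv_le:
  assumes "\<bar>p\<bar> < 1" "cmod z \<le> 1"
  shows "cmod (disc_inv p z) \<le> 1"
proof -
  have "0 \<le> 1 - (cmod (disc_inv p z))\<^sup>2"
    unfolding one_minus_norm_disc_inv[OF assms] using assms
    by (intro divide_nonneg_nonneg mult_nonneg_nonneg) (auto simp: abs_square_le_1 power_le_one)
  then show ?thesis by (simp add: abs_square_le_1)
qed

lemma norm_disc_inv_less:
  assumes "\<bar>p\<bar> < 1" "cmod z < 1"
  shows "cmod (disc_inv p z) < 1"
proof -
  have "0 < 1 - (cmod (disc_inv p z))\<^sup>2"
    using assms disc_inv_denom_nz[of p z]
    by (subst one_minus_norm_disc_inv) (auto intro!: divide_pos_pos mult_pos_pos simp: abs_square_less_1)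
  then show ?thesis by (simp add: abs_square_less_1)
qed

text \<open>Transports the factor \<open>1 - p z\<close> through the change of variable; this is how
  the power of \<open>1 - m x\<close> in the final bounds arises.\<close>

lemma one_minus_mult_disc_inv:
  assumes "\<bar>p\<bar> < 1" "cmod z \<le> 1"
  shows "1 - of_real p * disc_inv p z = of_real (1 - p\<^sup>2) / (1 - of_real p * z)"
  using disc_inv_denom_nz[OF assms] by (simp add: disc_inv_def field_simps power2_eq_square)

lemma disc_inv_disc_inv:
  assumes "\<bar>p\<bar> < 1" "cmod z \<le> 1"
  shows "disc_inv p (disc_inv p z) = z"
proof -
  have "1 - p\<^sup>2 \<noteq> 0" using assms abs_square_less_1[of p] by linarith
  then have nz: "(of_real (1 - p\<^sup>2) :: complex) \<noteq> 0" unfolding of_real_eq_0_iff .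
  have "of_real p - disc_inv p z = of_real (1 - p\<^sup>2) * z / (1 - of_real p * z)"
    using disc_inv_denom_nz[OF assms] by (simp add: disc_inv_def field_simps power2_eq_square)
  then show ?thesis
    using disc_inv_denom_nz[OF assms] nz
    by (simp add: disc_inv_def[of p "disc_inv p z"] one_minus_mult_disc_inv[OF assms] del: of_real_diff)
qed

lemma holomorphic_disc_inv:
  assumes "\<bar>p\<bar> < 1"
  shows "disc_inv p holomorphic_on ball 0 1"
  unfolding disc_inv_def using disc_inv_denom_nz[OF assms]
  by (auto intro!: holomorphic_intros)

section \<open>The Schwarz lemma and Schwarz--Pick estimates at a fixed point\<close>

text \<open>For \<open>0 < c < 1\<close> the function \<open>c f\<close> satisfies the strict bound
  of the Schwarz lemma; then \<open>c\<close> tends to 1. The weak bound is the one that a maximum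
  principle delivers.\<close>

lemma Schwarz_weak:
  assumes "f holomorphic_on ball 0 1" "f 0 = 0" "\<And>z. cmod z < 1 \<Longrightarrow> cmod (f z) \<le> 1" "cmod \<xi> < 1"
  shows "cmod (f \<xi>) \<le> cmod \<xi>"
proof (rule field_le_mult_one_interval)
  fix c :: real assume c: "0 < c" "c < 1"
  have "cmod (of_real c * f \<xi>) \<le> cmod \<xi>"
  proof (rule Schwarz_Lemma(1)[of "\<lambda>z. of_real c * f z"])
    fix z :: complex assume "cmod z < 1"
    then have "c * cmod (f z) \<le> c * 1" using assms(3)[of z] c by (intro mult_left_mono) auto
    then have "c * cmod (f z) < 1" using c by linarith
    then show "cmod (of_real c * f z) < 1" using c by (simp add: norm_mult)
  qed (use assms in \<open>auto intro!: holomorphic_intros\<close>)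
  then show "c * cmod (f \<xi>) \<le> cmod \<xi>" using c by (simp add: norm_mult)
qed

text \<open>Conjugating \<open>f\<close> by \<open>disc_inv p\<close> moves the fixed point
  \<open>p\<close> to 0, where the Schwarz lemma applies.\<close>

lemma Schwarz_Pick_fixed_point:
  fixes p :: real
  assumes f: "f holomorphic_on ball 0 1" "\<And>z. cmod z < 1 \<Longrightarrow> cmod (f z) \<le> 1"
    and p: "\<bar>p\<bar> < 1" "f (of_real p) = of_real p" and z: "cmod z < 1"
  shows "cmod (disc_inv p (f z)) \<le> cmod (disc_inv p z)"
proof -
  let ?D = "\<lambda>w. (of_real p - f (disc_inv p w)) / (1 - of_real p * f (disc_inv p w))"
  have sub: "disc_inv p ` ball 0 1 \<subseteq> ball 0 1"
    using norm_disc_inv_less[OF p(1)] by auto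
  have hol: "(\<lambda>w. f (disc_inv p w)) holomorphic_on ball 0 1"
    using holomorphic_on_compose_gen[OF holomorphic_disc_inv[OF p(1)] f(1) sub] by (simp add: o_def)
  have *: "(\<lambda>w. disc_inv p (f (disc_inv p w))) holomorphic_on ball 0 1"
    unfolding disc_inv_def[of p "f _"]
  proof (intro holomorphic_intros hol)
    fix w :: complex assume "w \<in> ball 0 1"
    then show "1 - of_real p * f (disc_inv p w) \<noteq> 0"
      using disc_inv_denom_nz[OF p(1)] f(2) norm_disc_inv_less[OF p(1)] by simp
  qed
  have "cmod (disc_inv p (f (disc_inv p (disc_inv p z)))) \<le> cmod (disc_inv p z)"
  proof (rule Schwarz_weak[OF *])
    show "disc_inv p (f (disc_inv p 0)) = 0" using p by (simp add: disc_inv_def)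
    show "cmod (disc_inv p (f (disc_inv p w))) \<le> 1" if "cmod w < 1" for w
      using norm_disc_inv_le[OF p(1)] f(2) norm_disc_inv_less[OF p(1) that] by simp
    show "cmod (disc_inv p z) < 1" using norm_disc_inv_less[OF p(1) z] .
  qed
  then show ?thesis using disc_inv_disc_inv[OF p(1), of z] z by simp
qed

text \<open>By Schwarz--Pick, \<open>f q\<close> lies in a pseudo-hyperbolic disc about
  \<open>p\<close> whose boundary passes through \<open>q\<close>. This is a Euclidean disc
  symmetric about the real axis with centre at least 0. If \<open>q \<le> p\<close>, then
  \<open>q\<close> is its leftmost point; if \<open>p \<le> q\<close>, then \<open>q\<close> is its
  rightmost point and hence its point of largest modulus.\<close>

lemma Schwarz_Pick_fixed_point_real:
  fixes p q :: real
  assumes f: "f holomorphic_on ball 0 1" "\<And>z. cmod z < 1 \<Longrightarrow> cmod (f z) \<le> 1"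
    and p: "0 \<le> p" "p < 1" "f (of_real p) = of_real p" and q: "\<bar>q\<bar> < 1"
  shows "q \<le> p \<Longrightarrow> q \<le> Re (f (of_real q))" and "p \<le> q \<Longrightarrow> cmod (f (of_real q)) \<le> q"
proof -
  define k where "k = f (of_real q)"
  have k1: "cmod k \<le> 1" using f(2) q by (simp add: k_def)
  define \<delta> where "\<delta> = \<bar>p - q\<bar> / (1 - p * q)"
  have pq: "p * q < 1" "p * q > -1"
    using p q mult_mono[of p 1 "\<bar>q\<bar>" "\<bar>q\<bar>"] abs_mult[of p q] by (auto simp: abs_less_iff)
  have T: "disc_inv p (of_real q) = of_real ((p - q) / (1 - p * q))"
    by (simp add: disc_inv_def)
  have "cmod (disc_inv p (of_real q)) = \<delta>"
    unfolding T norm_of_real using pq by (simp add: \<delta>_def abs_divide)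
  then have SP: "cmod (disc_inv p k) \<le> \<delta>"
    using Schwarz_Pick_fixed_point[OF f, of p "of_real q"] p q by (simp add: k_def)
  have \<delta>: "0 \<le> \<delta>" "\<delta> < 1"
    using norm_disc_inv_less[of p "of_real q"] p q \<open>cmod (disc_inv p (of_real q)) = \<delta>\<close> by auto
  have nz: "1 - of_real p * k \<noteq> 0" using disc_inv_denom_nz[of p k] p k1 by auto
  have "cmod (of_real p - k) \<le> \<delta> * cmod (1 - of_real p * k)"
    using SP nz by (simp add: disc_inv_def norm_divide field_simps)
  then have "(cmod (of_real p - k))\<^sup>2 \<le> (\<delta> * cmod (1 - of_real p * k))\<^sup>2"
    by (intro power_mono) auto
  then have main: "(p - Re k)\<^sup>2 + (Im k)\<^sup>2 \<le> \<delta>\<^sup>2 * ((1 - p * Re k)\<^sup>2 + p\<^sup>2 * (Im k)\<^sup>2)"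
    by (simp add: cmod_power2 power_mult_distrib)
  have \<delta>p: "\<delta>\<^sup>2 * p\<^sup>2 \<le> 1" 
    using \<delta> p by (simp add: power_le_one mult_le_one)
  have xk: "\<bar>Re k\<bar> \<le> 1" using k1 abs_Re_le_cmod[of k] by linarith
  have strict: "p * p < 1" using p mult_strict_mono[of p 1 p 1] by (cases "p = 0") auto
  show "q \<le> Re (f (of_real q))" if "q \<le> p"
  proof (rule ccontr)
    assume "\<not> ?thesis"
    then have lt: "Re k < q" by (simp add: k_def)
    have "\<delta>\<^sup>2 * p\<^sup>2 * (Im k)\<^sup>2 \<le> (Im k)\<^sup>2" using mult_right_mono[OF \<delta>p, of "(Im k)\<^sup>2"] by simp
    then have "(p - Re k)\<^sup>2 \<le> (\<delta> * (1 - p * Re k))\<^sup>2"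
      using main unfolding power_mult_distrib distrib_left mult.assoc by linarith
    moreover have "p * Re k \<le> 1" using p xk mult_left_mono[of "Re k" 1 p] by linarith
    ultimately have "p - Re k \<le> \<delta> * (1 - p * Re k)"
      using \<delta> by (meson diff_ge_0_iff_ge mult_nonneg_nonneg power2_le_imp_le)
    then have "(p - Re k) * (1 - p * q) \<le> (p - q) * (1 - p * Re k)"
      using pq that by (simp add: \<delta>_def field_simps)
    then have "(q - Re k) * (1 - p * p) \<le> 0" by (simp add: algebra_simps)
    then show False using lt strict by (simp add: mult_le_0_iff)
  qed
  show "cmod (f (of_real q)) \<le> q" if "p \<le> q"
  proof -
    define \<rho> where "\<rho> = cmod k"
    have sq: "\<rho>\<^sup>2 = (Re k)\<^sup>2 + (Im k)\<^sup>2" by (simp add: \<rho>_def cmod_power2)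
    \<comment> \<open>For fixed modulus, \<open>main\<close> depends on \<open>k\<close> only
      through \<open>Re k\<close>, with a nonnegative coefficient; hence \<open>k\<close> may be
      replaced by its modulus.\<close>
    have "\<rho>\<^sup>2 + p\<^sup>2 - \<delta>\<^sup>2 * (1 + p\<^sup>2 * \<rho>\<^sup>2) \<le> (1 - \<delta>\<^sup>2) * (2 * p * Re k)"
      using main unfolding sq by (simp add: algebra_simps power2_eq_square)
    also have "\<dots> \<le> (1 - \<delta>\<^sup>2) * (2 * p * \<rho>)"
      using \<delta> p complex_Re_le_cmod[of k] by (intro mult_left_mono) (auto simp: \<rho>_def power_le_one)
    finally have "(\<rho> - p)\<^sup>2 \<le> (\<delta> * (1 - p * \<rho>))\<^sup>2"
      by (simp add: algebra_simps power2_eq_square)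
    moreover have "p * \<rho> \<le> 1" using p k1 by (simp add: \<rho>_def mult_le_one)
    ultimately have "\<rho> - p \<le> \<delta> * (1 - p * \<rho>)"
      using \<delta> by (meson diff_ge_0_iff_ge mult_nonneg_nonneg power2_le_imp_le)
    then have "(\<rho> - p) * (1 - p * q) \<le> (q - p) * (1 - p * \<rho>)"
      using pq that by (simp add: \<delta>_def field_simps)
    then have "(\<rho> - q) * (1 - p * p) \<le> 0" by (simp add: algebra_simps)
    then show ?thesis using strict by (simp add: mult_le_0_iff \<rho>_def k_def)
  qed
qed

section \<open>The profile function\<close>

text \<open>The dimension and \<alpha> enter the profile only through \<open>b\<close>, so the
  one-variable theory is written in \<open>b\<close> alone.\<close>

definition disc_phi :: "real \<Rightarrow> real \<Rightarrow> real" where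
  "disc_phi b x = x * (1 - x\<^sup>2) powr (b / 2) * sqrt (b + 1) * ((b + 1) / b) powr (b / 2)"

lemma bloch_phi_eq_disc_phi: "bloch_phi \<alpha> n = disc_phi (\<alpha> * (real n + 1))"
  by (simp add: fun_eq_iff bloch_phi_def disc_phi_def)

text \<open>\<open>exp (- c * Ln z)\<close> is the principal branch of the power \<open>z\<close> to
  \<open>-c\<close>; on the positive axis it has to agree with the real \<open>powr\<close> of the
  bounds.\<close>

lemma exp_mult_Ln_of_real:
  assumes "0 < y"
  shows "exp (- of_real c * Ln (of_real y)) = of_real (y powr (- c))"
  using assms by (simp add: Ln_of_real powr_def exp_of_real[symmetric])

lemma norm_exp_mult_Ln:
  assumes "z \<noteq> 0"
  shows "cmod (exp (- of_real c * Ln z)) = cmod z powr (- c)"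
  using assms by (simp add: powr_def)

context
  fixes b a :: real
  assumes b: "0 < b" and a: "a = 1 / sqrt (b + 1)"
begin

lemma crit_point_bounds: "0 < a" "a < 1" "a\<^sup>2 = 1 / (b + 1)"
  using b by (auto simp: a power_divide)

text \<open>At \<open>a\<close> the factors \<open>1 - x\<^sup>2\<close> and
  \<open>(b + 1) / b\<close> are reciprocal, and so are \<open>x\<close> and
  \<open>sqrt (b + 1)\<close>: the constants in the profile normalise its peak.\<close>

lemma disc_phi_crit_point: "disc_phi b a = 1"
proof -
  have "1 - a\<^sup>2 = inverse ((b + 1) / b)" using b by (simp add: crit_point_bounds field_simps)
  then have "(1 - a\<^sup>2) powr (b / 2) * ((b + 1) / b) powr (b / 2) = 1"
    using b powr_mult[of "1 - a\<^sup>2" "(b + 1) / b" "b / 2"] by simp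
  moreover have "a * sqrt (b + 1) = 1" using b by (simp add: a)
  ultimately show ?thesis by (simp add: disc_phi_def mult.commute mult.left_commute)
qed

text \<open>With \<open>u = (b + 1) x\<^sup>2\<close> and \<open>v = (1 - x\<^sup>2) (b + 1) / b\<close> one has \<open>u + b v = b + 1\<close>, so the bound
  is \<open>ln t \<le> t - 1\<close> applied to both factors of the squared profile.\<close>
lemma disc_phi_le_1:
  assumes x: "0 \<le> x" "x < 1"
  shows "disc_phi b x \<le> 1"
proof (cases "x = 0")
  case False
  have x2: "0 < 1 - x\<^sup>2" using x by (simp add: abs_square_less_1)
  define u where "u = (b + 1) * x\<^sup>2"
  define v where "v = (1 - x\<^sup>2) * ((b + 1) / b)"
  have uv: "0 < u" "0 < v" using b x2 False by (auto simp: u_def v_def)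
  have "u + b * v = b + 1" using b by (simp add: u_def v_def field_simps)
  moreover have "b * ln v \<le> b * (v - 1)"
    using b uv by (intro mult_left_mono ln_le_minus_one) auto
  ultimately have "ln u / 2 + b / 2 * ln v \<le> 0"
    using ln_le_minus_one[OF uv(1)] by (simp add: algebra_simps)
  then have le: "exp (ln u / 2 + b / 2 * ln v) \<le> 1" by simp
  have "exp (ln u / 2 + b / 2 * ln v) = sqrt u * v powr (b / 2)"
    using uv by (simp add: exp_add powr_def ln_sqrt[symmetric])
  moreover have "sqrt u = x * sqrt (b + 1)"
    using x by (simp add: u_def real_sqrt_mult)
  moreover have "v powr (b / 2) = (1 - x\<^sup>2) powr (b / 2) * ((b + 1) / b) powr (b / 2)"
    unfolding v_def by (rule powr_mult)
  ultimately have "exp (ln u / 2 + b / 2 * ln v) = disc_phi b x" by (simp add: disc_phi_def mult_ac)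
  then show ?thesis using le by simp
qed (simp add: disc_phi_def)

lemma continuous_on_disc_phi: "continuous_on {0..a} (disc_phi b)"
proof -
  have "1 - x\<^sup>2 \<noteq> 0" if "x \<in> {0..a}" for x :: real
    using that crit_point_bounds abs_square_less_1[of x] by force
  then show ?thesis
    unfolding disc_phi_def using b by (intro continuous_intros) auto
qed

text \<open>The derivative is a positive factor times \<open>1 - (b + 1) x\<^sup>2\<close>, which is
  positive on \<open>[0, a)\<close> because \<open>a\<^sup>2 = 1 / (b + 1)\<close>.\<close>

lemma disc_phi_strict_mono:
  assumes xy: "0 \<le> x" "x < y" "y \<le> a"
  shows "disc_phi b x < disc_phi b y"
proof -
  define K where "K = sqrt (b + 1) * ((b + 1) / b) powr (b / 2)"
  have K: "0 < K" using b by (simp add: K_def)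
  have eq: "disc_phi b = (\<lambda>x. K * (x * (1 - x\<^sup>2) powr (b / 2)))"
    by (simp add: fun_eq_iff disc_phi_def K_def)
  show ?thesis
  proof (rule DERIV_pos_imp_increasing_open[OF xy(2)])
    fix z assume z: "x < z" "z < y"
    then have z1: "0 < 1 - z\<^sup>2"
      using xy crit_point_bounds abs_square_less_1[of z] by force
    have "z\<^sup>2 < a\<^sup>2" using z xy by (intro power_strict_mono) auto
    then have za: "(b + 1) * z\<^sup>2 < 1" using b by (simp add: crit_point_bounds field_simps)
    \<comment> \<open>One power is split off so that both terms of the product rule share the factor
      with exponent \<open>b / 2 - 1\<close>.\<close>
    have pw: "(1 - z\<^sup>2) powr (b / 2) = (1 - z\<^sup>2) powr (b / 2 - 1) * (1 - z\<^sup>2)"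
      using z1 by (simp add: powr_diff)
    have "(disc_phi b has_real_derivative
        K * ((1 - z\<^sup>2) powr (b / 2 - 1) * (1 - (b + 1) * z\<^sup>2))) (at z)"
      unfolding eq using z1
      by (auto intro!: derivative_eq_intros simp: pw) (simp add: field_simps power2_eq_square)
    moreover have "0 < K * ((1 - z\<^sup>2) powr (b / 2 - 1) * (1 - (b + 1) * z\<^sup>2))"
      using K za z1 by simp
    ultimately show "\<exists>D. (disc_phi b has_real_derivative D) (at z) \<and> 0 < D" by blast
  next
    show "continuous_on {x..y} (disc_phi b)"
      using xy by (intro continuous_on_subset[OF continuous_on_disc_phi]) auto
  qed
qed

lemma disc_phi_pos:
  assumes "0 < x" "x \<le> a"
  shows "0 < disc_phi b x"
  using disc_phi_strict_mono[of 0 x] assms by (simp add: disc_phi_def)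

text \<open>The intermediate value theorem between the values 0 at 0 and 1 at \<open>a\<close>, with
  strict monotonicity for uniqueness. It makes the definite description behind
  \<open>bloch_m\<close> meaningful.\<close>

lemma disc_phi_ex1:
  assumes "0 < lam" "lam \<le> 1"
  shows "\<exists>!x. x \<in> {0..a} \<and> disc_phi b x = lam"
proof -
  have "\<exists>x\<ge>0. x \<le> a \<and> disc_phi b x = lam"
    using assms crit_point_bounds disc_phi_crit_point
    by (intro IVT' continuous_on_disc_phi) (auto simp: disc_phi_def[of _ 0])
  moreover have "x = y" if "x \<in> {0..a}" "y \<in> {0..a}" "disc_phi b x = disc_phi b y" for x y
    using disc_phi_strict_mono[of x y] disc_phi_strict_mono[of y x] that by force
  ultimately show ?thesis by force
qed

section \<open>The distortion theorem in the unit disc\<close>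

text \<open>The condition \<open>m < a\<close> puts the fixed point \<open>m / a\<close> of the
  rescaled function inside the unit disc. The second condition on \<open>x\<close> says that its
  image under \<open>disc_inv m\<close> lies in the disc of radius \<open>a\<close>, where the
  comparison function is controlled.\<close>

lemma disc_distortion_strict:
  fixes g :: "complex \<Rightarrow> complex" and m x :: real
  assumes g: "g holomorphic_on ball 0 1"
    and bd: "\<And>z. cmod z < 1 \<Longrightarrow> (1 - (cmod z)\<^sup>2) powr (b / 2) * cmod (g z) \<le> 1"
    and m: "0 < m" "m < a" "g 0 = of_real (disc_phi b m)"
    and x: "\<bar>x\<bar> < 1" "\<bar>(m - x) / (1 - m * x)\<bar> < a"
  defines "B \<equiv> disc_phi b m * (m - x) / (m * (1 - m * x) powr (b + 1))"
  shows "0 \<le> x \<Longrightarrow> B \<le> Re (g (of_real x))" and "x \<le> 0 \<Longrightarrow> cmod (g (of_real x)) \<le> B"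
proof -
  have m1: "\<bar>m\<bar> < 1" and a1: "0 < a" "a < 1" using m crit_point_bounds by auto
  define lam where "lam = disc_phi b m"
  have lam: "0 < lam" using disc_phi_pos m by (simp add: lam_def)
  have mm: "0 < 1 - m\<^sup>2" using m1 abs_square_less_1[of m] by simp
  \<comment> \<open>The constant for which \<open>h m = m\<close>.\<close>
  define c where "c = m / lam * (1 - m\<^sup>2) powr b"
  have c: "0 < c" using m lam mm by (simp add: c_def)
  define h where "h = (\<lambda>w. of_real c * g (disc_inv m w) * exp (- of_real b * Ln (1 - of_real m * w)))"
  have re: "0 < Re (1 - of_real m * w)" if "cmod w < 1" for w :: complex
  proof -
    have "cmod (of_real m * w) < 1"
      using m1 m that mult_le_one[of m "cmod w"] mult_strict_mono[of m 1 "cmod w" 1]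
      by (simp add: norm_mult)
    then show ?thesis using complex_Re_le_cmod[of "of_real m * w"] by simp
  qed
  have hol: "h holomorphic_on ball 0 1"
    unfolding h_def
  proof (intro holomorphic_intros)
    show "(\<lambda>w. g (disc_inv m w)) holomorphic_on ball 0 1"
      using holomorphic_on_compose_gen[OF holomorphic_disc_inv[OF m1] g] norm_disc_inv_less[OF m1]
      by (force simp: o_def)
    fix w :: complex assume "w \<in> ball 0 1"
    then show "1 - of_real m * w \<notin> \<real>\<^sub>\<le>\<^sub>0"
      using re[of w] by (auto simp: complex_nonpos_Reals_iff)
  qed
  \<comment> \<open>The growth bound is applied at \<open>disc_inv m w\<close>. Its weight splits
    into \<open>P\<close>, \<open>Q\<close> and a power of \<open>D\<close>, and the normalisation
    \<open>disc_phi b a = 1\<close> turns the resulting constant \<open>1 / (C * Q)\<close> into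
    exactly \<open>a\<close>.\<close>
  have circle: "cmod (h w) \<le> a" if w: "cmod w = a" for w
  proof -
    define D where "D = cmod (1 - of_real m * w)"
    have D: "0 < D" using disc_inv_denom_nz[OF m1, of w] w a1 by (simp add: D_def)
    define P where "P = (1 - m\<^sup>2) powr (b / 2)"
    define Q where "Q = (1 - a\<^sup>2) powr (b / 2)"
    define C where "C = sqrt (b + 1) * ((b + 1) / b) powr (b / 2)"
    have aa: "0 < 1 - a\<^sup>2" using a1 abs_square_less_1[of a] by simp
    have pos: "0 < P" "0 < Q" "0 < C" using mm aa b by (auto simp: P_def Q_def C_def)
    have PP: "(1 - m\<^sup>2) powr b = P * P" using mm by (simp add: P_def powr_add[symmetric])
    have "lam = C * m * P" by (simp add: lam_def disc_phi_def C_def P_def)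
    then have cP: "c = P / C" using m pos by (simp add: c_def PP field_simps)
    have "a * (C * Q) = 1"
      using disc_phi_crit_point by (simp add: disc_phi_def C_def Q_def mult_ac)
    then have CQ: "a = 1 / (C * Q)"
      using pos nonzero_eq_divide_eq[of "C * Q" a 1] by simp
    have "(D\<^sup>2) powr (b / 2) = D powr b"
      using D by (simp add: powr_powr flip: powr_numeral)
    then have "(1 - (cmod (disc_inv m w))\<^sup>2) powr (b / 2) = P * Q * D powr (- b)"
      using one_minus_norm_disc_inv[OF m1, of w] w a1 mm aa
      by (simp add: D_def[symmetric] powr_divide powr_mult P_def Q_def powr_minus_divide)
    then have 1: "P * Q * D powr (- b) * cmod (g (disc_inv m w)) \<le> 1"
      using bd[of "disc_inv m w"] norm_disc_inv_less[OF m1, of w] w a1 by simp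
    have "cmod (h w) = P / C * cmod (g (disc_inv m w)) * D powr (- b)"
      using D pos norm_exp_mult_Ln[of "1 - of_real m * w" b] unfolding h_def cP
      by (simp add: norm_mult norm_divide D_def)
    also have "\<dots> \<le> a"
      unfolding CQ using 1 pos by (simp add: field_simps)
    finally show ?thesis .
  qed
  \<comment> \<open>Rescaling from radius \<open>a\<close> to the unit disc; the maximum principle
    extends the bound on the circle to the interior.\<close>
  define k where "k = (\<lambda>v. h (of_real a * v) / of_real a)"
  have sub: "cmod (of_real a * v) \<le> a" if "cmod v \<le> 1" for v
    using that a1 by (simp add: norm_mult)
  have "(\<lambda>v. complex_of_real a * v) ` cball 0 1 \<subseteq> ball 0 1"
  proof (rule image_subsetI)
    fix v :: complex assume "v \<in> cball 0 1"
    then show "of_real a * v \<in> ball 0 1" using sub[of v] a1 by simp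
  qed
  then have "(\<lambda>v. h (of_real a * v)) holomorphic_on cball 0 1"
    using holomorphic_on_compose_gen[OF _ hol, of "\<lambda>v. of_real a * v" "cball 0 1"]
    by (auto simp: o_def intro!: holomorphic_intros)
  then have kcb: "k holomorphic_on cball 0 1"
    unfolding k_def using a1 by (intro holomorphic_intros) auto
  have k: "k holomorphic_on ball 0 1"
    using holomorphic_on_subset[OF kcb] ball_subset_cball by blast
  have k1: "cmod (k v) \<le> 1" if "cmod v < 1" for v
  proof (rule maximum_modulus_frontier[of k "cball 0 1"])
    show "cmod (k z) \<le> 1" if "z \<in> frontier (cball 0 1)" for z
      using that circle[of "of_real a * z"] a1 by (simp add: k_def norm_divide norm_mult)
  qed (use k kcb that in \<open>auto intro: holomorphic_on_imp_continuous_on\<close>)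
  have hm: "h (of_real m) = of_real m"
  proof -
    have 0: "disc_inv m (of_real m) = 0" by (simp add: disc_inv_def)
    have "1 - of_real m * of_real m = complex_of_real (1 - m\<^sup>2)" by (simp add: power2_eq_square)
    then have "h (of_real m) = of_real (c * lam * (1 - m\<^sup>2) powr (- b))"
      using exp_mult_Ln_of_real[OF mm, of b] m by (simp add: h_def 0 lam_def)
    also have "c * lam * (1 - m\<^sup>2) powr (- b) = m"
      using mm lam by (simp add: c_def powr_minus field_simps)
    finally show ?thesis .
  qed
  have kp: "k (of_real (m / a)) = of_real (m / a)" using hm a1 by (simp add: k_def)
  \<comment> \<open>As \<open>disc_inv m\<close> is an involution, \<open>h\<close> at this
    \<open>w\<close> is an explicit positive multiple of \<open>g x\<close>.\<close>
  define w where "w = (m - x) / (1 - m * x)"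
  have mx: "0 < 1 - m * x"
    using re[of "of_real x"] x by simp
  have wT: "of_real w = disc_inv m (of_real x)" by (simp add: w_def disc_inv_def)
  have Tw: "disc_inv m (of_real w) = of_real x" unfolding wT using disc_inv_disc_inv[OF m1] x by simp
  have mw: "1 - of_real m * of_real w = complex_of_real ((1 - m\<^sup>2) / (1 - m * x))"
    unfolding wT using one_minus_mult_disc_inv[OF m1, of "of_real x"] x by simp
  have "h (of_real w) = of_real (c * ((1 - m\<^sup>2) / (1 - m * x)) powr (- b)) * g (of_real x)"
    using exp_mult_Ln_of_real[of "(1 - m\<^sup>2) / (1 - m * x)" b] mm mx
    unfolding h_def Tw mw by (simp del: of_real_divide of_real_diff)
  also have "c * ((1 - m\<^sup>2) / (1 - m * x)) powr (- b) = m / lam * (1 - m * x) powr b"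
    using mm mx lam m by (simp add: c_def powr_minus powr_divide field_simps)
  finally have hw: "h (of_real w) = of_real (m / lam * (1 - m * x) powr b) * g (of_real x)" .
  define s where "s = m / lam * (1 - m * x) powr b"
  have s: "0 < s" using m lam mx by (simp add: s_def)
  \<comment> \<open>The denominator of \<open>w\<close> supplies the extra power of
    \<open>1 - m x\<close> that raises the exponent from \<open>b\<close> to
    \<open>b + 1\<close>.\<close>
  have B: "B = w / s"
    using mx m lam by (simp add: B_def w_def s_def powr_add lam_def field_simps)
  have kw: "k (of_real (w / a)) = of_real (s / a) * g (of_real x)"
    using hw a1 by (simp add: k_def s_def)
  have q: "\<bar>w / a\<bar> < 1" using x(2)[folded w_def] a1 by (simp add: abs_divide)
  have p: "0 \<le> m / a" "m / a < 1" using m a1 by auto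
  note SP = Schwarz_Pick_fixed_point_real[OF k k1 p kp q, unfolded kw]
  show "B \<le> Re (g (of_real x))" if "0 \<le> x"
  proof -
    \<comment> \<open>The sign of \<open>x\<close> decides on which side of the fixed point
      \<open>w\<close> lies: the difference of the two sides is
      \<open>x (1 - m\<^sup>2)\<close>.\<close>
    have "m - x \<le> m * (1 - m * x)"
      using that mm mult_nonneg_nonneg[of x "1 - m\<^sup>2"] by (simp add: algebra_simps power2_eq_square)
    then have "w \<le> m" using mx by (simp add: w_def field_simps)
    then have "w / a \<le> Re (of_real (s / a) * g (of_real x))"
      using a1 by (intro SP(1)) (auto simp: divide_right_mono)
    then show ?thesis using s a1 by (simp add: B field_simps)
  qed
  show "cmod (g (of_real x)) \<le> B" if "x \<le> 0"
  proof -
    have "m * (1 - m * x) \<le> m - x"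
      using that mm mult_nonpos_nonneg[of x "1 - m\<^sup>2"] by (simp add: algebra_simps power2_eq_square)
    then have "m \<le> w" using mx by (simp add: w_def field_simps)
    then have "cmod (of_real (s / a) * g (of_real x)) \<le> w / a"
      using a1 by (intro SP(2)) (auto simp: divide_right_mono)
    then show ?thesis using s a1 by (simp add: B norm_mult norm_divide field_simps)
  qed
qed

text \<open>Rescaling both the value at the origin and the point by a factor \<open>t < 1\<close> makes the
  hypotheses of \<open>disc_distortion_strict\<close> hold; letting \<open>t\<close> tend to 1 covers the extreme value
  \<open>m = a\<close>, where the fixed point of the Schwarz--Pick argument would lie on the boundary.\<close>
lemma disc_distortion:
  fixes g :: "complex \<Rightarrow> complex" and m x :: real
  assumes g: "g holomorphic_on ball 0 1"
    and bd: "\<And>z. cmod z < 1 \<Longrightarrow> (1 - (cmod z)\<^sup>2) powr (b / 2) * cmod (g z) \<le> 1"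
    and m: "0 < m" "m \<le> a" "g 0 = of_real (disc_phi b m)"
    and x: "\<bar>x\<bar> < 1" "\<bar>m - x\<bar> \<le> a * (1 - m * x)"
  defines "B \<equiv> disc_phi b m * (m - x) / (m * (1 - m * x) powr (b + 1))"
  shows "0 \<le> x \<Longrightarrow> B \<le> Re (g (of_real x))" and "x \<le> 0 \<Longrightarrow> cmod (g (of_real x)) \<le> B"
proof -
  have a1: "0 < a" "a < 1" using crit_point_bounds by auto
  define lam where "lam = disc_phi b m"
  have lam: "0 < lam" using disc_phi_pos m by (simp add: lam_def)
  have mx: "\<bar>m * x\<bar> < 1"
    using m a1 x mult_left_le_one_le[of "\<bar>x\<bar>" m] by (simp add: abs_mult)
  define B' where "B' = (\<lambda>t. lam * (m - x) / (m * (1 - t * t * m * x) powr (b + 1)))"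
  have strict: "(0 \<le> x \<longrightarrow> B' t \<le> Re (g (of_real (t * x)))) \<and> (x \<le> 0 \<longrightarrow> cmod (g (of_real (t * x))) \<le> B' t)"
    if t: "0 < t" "t < 1" for t
  proof -
    \<comment> \<open>Multiplying \<open>g\<close> by \<open>s\<close> gives the value at 0 that
      belongs to the parameter \<open>t * m\<close>; since \<open>s \<le> 1\<close>, the growth
      bound survives.\<close>
    define s where "s = disc_phi b (t * m) / lam"
    have "t * m < m" using t m by simp
    moreover from this have "t * m < a" using m(2) by linarith
    ultimately have tm: "0 < t * m" "t * m < m" "t * m < a" using t m(1) by auto
    have s: "0 < s" "s \<le> 1"
      using disc_phi_pos[of "t * m"] disc_phi_strict_mono[of "t * m" m] tm m lam
      by (auto simp: s_def lam_def)
    have den: "0 < 1 - t * m * (t * x)"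
    proof -
      have "\<bar>t * t * (m * x)\<bar> < 1"
        using mx t mult_le_one[of t t] mult_left_le_one_le[of "\<bar>m * x\<bar>" "t * t"]
        by (simp add: abs_mult)
      then show ?thesis by (simp add: mult_ac abs_less_iff)
    qed
    have lt: "t * \<bar>m - x\<bar> < a * (1 - t * m * (t * x))"
    proof -
      have "t * \<bar>m - x\<bar> \<le> t * (a * (1 - m * x))" using x t by simp
      also have "t * (a * (1 - m * x)) = a * (1 - t * m * (t * x)) - a * (1 - t) * (1 + t * (m * x))"
        by (simp add: algebra_simps)
      also have "\<dots> < a * (1 - t * m * (t * x))"
      proof -
        have "\<bar>t * (m * x)\<bar> < 1"
          using mx t mult_left_le_one_le[of "\<bar>m * x\<bar>" t] by (simp add: abs_mult)
        then show ?thesis using a1 t by (auto simp: abs_less_iff)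
      qed
      finally show ?thesis .
    qed
    have "\<bar>(t * m - t * x) / (1 - t * m * (t * x))\<bar> = t * \<bar>m - x\<bar> / (1 - t * m * (t * x))"
      using den t by (simp add: abs_divide abs_mult right_diff_distrib[symmetric])
    also have "\<dots> < a" using den lt by (simp add: field_simps)
    finally have c1: "\<bar>(t * m - t * x) / (1 - t * m * (t * x))\<bar> < a" .
    have c2: "\<bar>t * x\<bar> < 1"
      using x t mult_left_le_one_le[of "\<bar>x\<bar>" t] by (simp add: abs_mult)
    have c3: "(1 - (cmod z)\<^sup>2) powr (b / 2) * cmod (of_real s * g z) \<le> 1" if "cmod z < 1" for z
    proof -
      have "s * ((1 - (cmod z)\<^sup>2) powr (b / 2) * cmod (g z)) \<le> 1"
        by (rule mult_le_one) (use bd[OF that] s in auto)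
      then show ?thesis using s by (simp add: norm_mult mult_ac)
    qed
    have c4: "of_real s * g 0 = of_real (disc_phi b (t * m))"
      using lam m by (simp add: s_def lam_def)
    have c5: "(\<lambda>z. of_real s * g z) holomorphic_on ball 0 1"
      using g by (intro holomorphic_intros)
    have "disc_phi b (t * m) * (t * m - t * x) / (t * m * (1 - t * m * (t * x)) powr (b + 1)) = s * B' t"
      using t m lam unfolding right_diff_distrib[symmetric] by (simp add: s_def B'_def mult_ac)
    then show ?thesis
      using disc_distortion_strict[OF c5 c3 tm(1,3) c4 c2 c1] s t
      by (simp add: norm_mult mult_le_0_iff zero_le_mult_iff)
  qed
  have "(B' \<longlongrightarrow> B' 1) (at_left 1)"
    unfolding B'_def using mx m by (intro tendsto_intros) auto
  then have lB: "(B' \<longlongrightarrow> B) (at_left 1)" by (simp add: B'_def B_def lam_def)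
  have "isCont g (of_real (1 * x))"
    using g x by (intro continuous_on_interior[OF holomorphic_on_imp_continuous_on]) auto
  then have lg: "((\<lambda>t. g (of_real (t * x))) \<longlongrightarrow> g (of_real (1 * x))) (at_left 1)"
    by (rule isCont_tendsto_compose) (intro tendsto_intros)
  have ev: "eventually (\<lambda>t::real. 0 < t \<and> t < 1) (at_left 1)"
    using eventually_at_left_real[of 0 "1::real"] by (rule eventually_mono) auto
  show "B \<le> Re (g (of_real x))" if "0 \<le> x"
  proof (rule tendsto_le[OF _ _ lB])
    show "((\<lambda>t. Re (g (of_real (t * x)))) \<longlongrightarrow> Re (g (of_real x))) (at_left 1)"
      using tendsto_Re[OF lg] by simp
    show "\<forall>\<^sub>F t in at_left 1. B' t \<le> Re (g (of_real (t * x)))"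
      using ev by (rule eventually_mono) (use strict that in auto)
  qed simp
  show "cmod (g (of_real x)) \<le> B" if "x \<le> 0"
  proof (rule tendsto_le[OF _ lB])
    show "((\<lambda>t. cmod (g (of_real (t * x)))) \<longlongrightarrow> cmod (g (of_real x))) (at_left 1)"
      using tendsto_norm[OF lg] by simp
    show "\<forall>\<^sub>F t in at_left 1. cmod (g (of_real (t * x))) \<le> B' t"
      using ev by (rule eventually_mono) (use strict that in auto)
  qed simp
qed

end

section \<open>The Jacobian determinant along complex lines\<close>

lemma holomorphic_deriv_parametric:
  fixes F :: "complex \<Rightarrow> complex \<Rightarrow> complex"
  assumes r: "0 < r"
    and cont: "continuous_on (cball \<zeta>\<^sub>0 r \<times> cball 0 r) (\<lambda>(\<zeta>, w). F \<zeta> w)"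
    and h1: "\<And>w. cmod w < r \<Longrightarrow> (\<lambda>\<zeta>. F \<zeta> w) holomorphic_on ball \<zeta>\<^sub>0 r"
    and h2: "\<And>\<zeta>. \<zeta> \<in> ball \<zeta>\<^sub>0 r \<Longrightarrow> F \<zeta> holomorphic_on ball 0 r"
  shows "(\<lambda>\<zeta>. deriv (F \<zeta>) 0) holomorphic_on ball \<zeta>\<^sub>0 r"
proof -
  have "bounded ((\<lambda>(\<zeta>, w). F \<zeta> w) ` (cball \<zeta>\<^sub>0 r \<times> cball 0 r))"
    using cont by (intro compact_imp_bounded compact_continuous_image compact_Times) auto
  then obtain M where M: "0 < M" "\<And>\<zeta> w. \<zeta> \<in> cball \<zeta>\<^sub>0 r \<Longrightarrow> w \<in> cball 0 r \<Longrightarrow> cmod (F \<zeta> w) \<le> M"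
    unfolding bounded_pos by fastforce
  define C where "C = 2 * M / (r / 2)\<^sup>2"
  have C: "0 < C" using M r by (simp add: C_def)
  define \<epsilon> where "\<epsilon> n = complex_of_real (r / 4 * inverse (real (Suc n)))" for n
  have \<epsilon>: "cmod (\<epsilon> n) = r / 4 * inverse (real (Suc n))" "\<epsilon> n \<noteq> 0" "cmod (\<epsilon> n) < r / 2" for n
  proof -
    have "0 < inverse (real (Suc n))" "inverse (real (Suc n)) \<le> 1" by (auto simp: field_simps)
    then have "0 < r / 4 * inverse (real (Suc n))" "r / 4 * inverse (real (Suc n)) < r / 2"
      using r mult_left_le[of "inverse (real (Suc n))" "r / 4"] by auto
    then show "cmod (\<epsilon> n) = r / 4 * inverse (real (Suc n))" "\<epsilon> n \<noteq> 0" "cmod (\<epsilon> n) < r / 2"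
      unfolding \<epsilon>_def norm_of_real of_real_eq_0_iff by linarith+
  qed
  have Taylor: "cmod ((F \<zeta> w - F \<zeta> 0) / w - deriv (F \<zeta>) 0) \<le> C * cmod w"
    if \<zeta>: "\<zeta> \<in> ball \<zeta>\<^sub>0 r" and w: "cmod w < r / 2" "w \<noteq> 0" for \<zeta> w
  proof -
    have hF: "F \<zeta> holomorphic_on ball 0 r" using h2 \<zeta> .
    have "cmod ((deriv ^^ 0) (F \<zeta>) w - (\<Sum>i\<le>1. (deriv ^^ i) (F \<zeta>) 0 * (w - 0) ^ i / fact i))
        \<le> C * cmod (w - 0) ^ (Suc 1) / fact 1"
    proof (rule complex_Taylor[of "ball 0 (r / 2)"])
      fix i x assume x: "x \<in> ball (0::complex) (r / 2)"
      then have "x \<in> ball 0 r" using r by auto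
      then show "((deriv ^^ i) (F \<zeta>) has_field_derivative (deriv ^^ Suc i) (F \<zeta>) x) (at x within ball 0 (r / 2))"
        using holomorphic_derivI[OF holomorphic_higher_deriv[OF hF], of x] by auto
    next
      fix x assume x: "x \<in> ball (0::complex) (r / 2)"
      have sub: "cball x (r / 2) \<subseteq> ball 0 r"
      proof
        fix y assume "y \<in> cball x (r / 2)"
        then show "y \<in> ball 0 r"
          using x norm_triangle_ineq2[of y x] by (auto simp: dist_norm norm_minus_commute)
      qed
      have "cmod ((deriv ^^ 2) (F \<zeta>) x) \<le> fact 2 * M / (r / 2) ^ 2"
      proof (rule Cauchy_inequality)
        show "F \<zeta> holomorphic_on ball x (r / 2)"
          using hF sub ball_subset_cball by (meson holomorphic_on_subset subset_trans)
        show "continuous_on (cball x (r / 2)) (F \<zeta>)"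
          using holomorphic_on_imp_continuous_on[OF hF] sub continuous_on_subset by blast
        show "cmod (F \<zeta> y) \<le> M" if "cmod (x - y) = r / 2" for y
        proof (rule M(2))
          show "y \<in> cball 0 r" using that sub by (force simp: dist_norm)
        qed (use \<zeta> in auto)
      qed (use r in auto)
      then show "cmod ((deriv ^^ Suc 1) (F \<zeta>) x) \<le> C" by (simp add: C_def numeral_2_eq_2)
    qed (use r w in auto)
    then have *: "cmod (F \<zeta> w - F \<zeta> 0 - deriv (F \<zeta>) 0 * w) \<le> C * (cmod w * cmod w)"
      by (simp add: diff_diff_eq)
    have "(F \<zeta> w - F \<zeta> 0) / w - deriv (F \<zeta>) 0 = (F \<zeta> w - F \<zeta> 0 - deriv (F \<zeta>) 0 * w) / w"
      using w by (simp add: field_simps)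
    then show ?thesis using * w by (simp add: norm_divide divide_le_eq mult.assoc)
  qed
  have ul: "uniform_limit (ball \<zeta>\<^sub>0 r) (\<lambda>n \<zeta>. (F \<zeta> (\<epsilon> n) - F \<zeta> 0) / \<epsilon> n) (\<lambda>\<zeta>. deriv (F \<zeta>) 0) sequentially"
  proof (rule uniform_limitI)
    fix e :: real assume e: "0 < e"
    have "(\<lambda>n. C * (r / 4 * inverse (real (Suc n)))) \<longlonglongrightarrow> C * (r / 4 * 0)"
      by (intro tendsto_intros LIMSEQ_inverse_real_of_nat)
    then have "\<forall>\<^sub>F n in sequentially. C * (r / 4 * inverse (real (Suc n))) < e"
      using e by (intro order_tendstoD(2)) auto
    then show "\<forall>\<^sub>F n in sequentially. \<forall>\<zeta>\<in>ball \<zeta>\<^sub>0 r. dist ((F \<zeta> (\<epsilon> n) - F \<zeta> 0) / \<epsilon> n) (deriv (F \<zeta>) 0) < e"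
    proof eventually_elim
      case (elim n)
      then show ?case
        using Taylor[of _ "\<epsilon> n"] \<epsilon>[of n] by (fastforce simp: dist_norm)
    qed
  qed
  show ?thesis
  proof (rule holomorphic_uniform_sequence)
    show "(\<lambda>\<zeta>. (F \<zeta> (\<epsilon> n) - F \<zeta> 0) / \<epsilon> n) holomorphic_on ball \<zeta>\<^sub>0 r" for n
      using \<epsilon>[of n] r by (intro holomorphic_intros h1) auto
    fix x assume "x \<in> ball \<zeta>\<^sub>0 r"
    then obtain d where "0 < d" "cball x d \<subseteq> ball \<zeta>\<^sub>0 r" using open_ball open_contains_cball by blast
    then show "\<exists>d>0. cball x d \<subseteq> ball \<zeta>\<^sub>0 r \<and>
        uniform_limit (cball x d) (\<lambda>n \<zeta>. (F \<zeta> (\<epsilon> n) - F \<zeta> 0) / \<epsilon> n) (\<lambda>\<zeta>. deriv (F \<zeta>) 0) sequentially"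
      using uniform_limit_on_subset[OF ul] by blast
  qed auto
qed

lemma norm_vector_scalar_mult:
  fixes v :: "complex^'n"
  shows "norm (c *s v) = cmod c * norm v"
  by (simp add: norm_vec_def L2_set_def norm_mult power_mult_distrib sum_distrib_left[symmetric]
      real_sqrt_mult)

lemma norm_axis: "norm (axis i c :: complex^'n) = cmod c"
  by (simp add: norm_vec_def L2_set_def axis_def if_distrib[of norm] if_distrib[of "\<lambda>x. x\<^sup>2"] cong: if_cong)

lemma bounded_linear_vector_scalar_mult_left:
  "bounded_linear (\<lambda>c. c *s (v :: complex^'n))"
proof -
  have "linear (\<lambda>c. c *s v)"
    by (rule linearI) (auto simp: vec_eq_iff algebra_simps)
  then show ?thesis by (simp add: linear_conv_bounded_linear)
qed

lemma holomorphic_map_on_line: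
  fixes f :: "complex^'n \<Rightarrow> complex^'m"
  assumes f: "holomorphic_map_on f S" and S: "open S" and U: "open U"
    and line: "\<And>w. w \<in> U \<Longrightarrow> p + w *s v \<in> S"
  shows "(\<lambda>w. f (p + w *s v) $ i) holomorphic_on U"
proof -
  have "\<exists>d. ((\<lambda>w. f (p + w *s v) $ i) has_field_derivative d) (at w)" if w: "w \<in> U" for w
  proof -
    obtain D where D: "(f has_derivative D) (at (p + w *s v))" "\<And>c v. D (c *s v) = c *s D v"
      using f line[OF w] at_within_open[OF line[OF w] S] unfolding holomorphic_map_on_def by metis
    have "((\<lambda>w. p + w *s v) has_derivative (\<lambda>h. h *s v)) (at w)"
      using has_derivative_add[OF has_derivative_const
          bounded_linear.has_derivative[OF bounded_linear_vector_scalar_mult_left has_derivative_ident]]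
      by auto
    from bounded_linear.has_derivative[OF bounded_linear_vec_nth has_derivative_compose[OF this D(1)]]
    have "((\<lambda>w. f (p + w *s v) $ i) has_derivative (\<lambda>h. D (h *s v) $ i)) (at w)" .
    moreover have "(\<lambda>h. D (h *s v) $ i) = (*) (D v $ i)"
      by (simp add: fun_eq_iff D(2) mult.commute)
    ultimately show ?thesis unfolding has_field_derivative_def by metis
  qed
  then show ?thesis using U by (simp add: holomorphic_on_open)
qed

lemma holomorphic_map_on_imp_continuous_on:
  "holomorphic_map_on f S \<Longrightarrow> continuous_on S f"
  unfolding holomorphic_map_on_def continuous_on_eq_continuous_within
  using has_derivative_continuous by blast

lemma holomorphic_on_partial_deriv_line:
  fixes f :: "complex^'n \<Rightarrow> complex^'m"
  assumes f: "holomorphic_map_on f S" and S: "open S" and U: "open U"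
    and line: "\<And>\<zeta>. \<zeta> \<in> U \<Longrightarrow> \<zeta> *s u \<in> S"
  shows "(\<lambda>\<zeta>. deriv (\<lambda>w. f (\<zeta> *s u + w *s e) $ i) 0) holomorphic_on U"
proof -
  have "(\<lambda>\<zeta>. deriv (\<lambda>w. f (\<zeta> *s u + w *s e) $ i) 0) field_differentiable at \<zeta>\<^sub>0" if \<zeta>0: "\<zeta>\<^sub>0 \<in> U" for \<zeta>\<^sub>0
  proof -
    obtain \<delta> where \<delta>: "0 < \<delta>" "cball (\<zeta>\<^sub>0 *s u) \<delta> \<subseteq> S"
      using line[OF \<zeta>0] S open_contains_cball by blast
    define r where "r = \<delta> / (norm u + norm e + 1)"
    have den: "0 < norm u + norm e + 1" by (smt (verit) norm_ge_zero)
    have r: "0 < r" using \<delta> den by (simp add: r_def)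
    have inS: "\<zeta> *s u + w *s e \<in> S" if "\<zeta> \<in> cball \<zeta>\<^sub>0 r" "w \<in> cball 0 r" for \<zeta> w
    proof -
      have "norm ((\<zeta> *s u + w *s e) - \<zeta>\<^sub>0 *s u) = norm ((\<zeta> - \<zeta>\<^sub>0) *s u + w *s e)"
        by (simp add: vector_ssub_ldistrib vector_sub_rdistrib algebra_simps)
      also have "\<dots> \<le> cmod (\<zeta> - \<zeta>\<^sub>0) * norm u + cmod w * norm e"
        unfolding norm_vector_scalar_mult[symmetric] by (rule norm_triangle_ineq)
      also have "\<dots> \<le> r * norm u + r * norm e"
        using that by (intro add_mono mult_right_mono) (auto simp: dist_norm norm_minus_commute)
      also have "\<dots> \<le> r * (norm u + norm e + 1)" using r by (simp add: algebra_simps)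
      also have "\<dots> = \<delta>" using den by (simp add: r_def)
      finally show ?thesis using \<delta>(2) by (auto simp: dist_norm norm_minus_commute subset_iff)
    qed
    have "(\<lambda>\<zeta>. deriv (\<lambda>w. f (\<zeta> *s u + w *s e) $ i) 0) holomorphic_on ball \<zeta>\<^sub>0 r"
    proof (rule holomorphic_deriv_parametric[OF r])
      have "continuous_on (cball \<zeta>\<^sub>0 r \<times> cball 0 r) (\<lambda>z. f (fst z *s u + snd z *s e))"
        by (rule continuous_on_compose2[OF holomorphic_map_on_imp_continuous_on[OF f]])
          (use inS in \<open>auto intro!: continuous_intros
             bounded_linear.continuous_on[OF bounded_linear_vector_scalar_mult_left]\<close>)
      then show "continuous_on (cball \<zeta>\<^sub>0 r \<times> cball 0 r) (\<lambda>(\<zeta>, w). f (\<zeta> *s u + w *s e) $ i)"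
        unfolding case_prod_beta by (intro continuous_intros)
      show "(\<lambda>\<zeta>. f (\<zeta> *s u + w *s e) $ i) holomorphic_on ball \<zeta>\<^sub>0 r" if "cmod w < r" for w
        using holomorphic_map_on_line[OF f S open_ball, of \<zeta>\<^sub>0 r "w *s e" u i] inS[of _ w] that
        by (simp add: add.commute)
      show "(\<lambda>w. f (\<zeta> *s u + w *s e) $ i) holomorphic_on ball 0 r" if "\<zeta> \<in> ball \<zeta>\<^sub>0 r" for \<zeta>
        using inS that by (intro holomorphic_map_on_line[OF f S open_ball]) auto
    qed
    then show ?thesis using r by (intro holomorphic_on_imp_differentiable_at[of _ "ball \<zeta>\<^sub>0 r"]) auto
  qed
  then show ?thesis using U by (simp add: holomorphic_on_def field_differentiable_at_within)
qed

lemma complex_jacobian_eq_deriv: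
  fixes f :: "complex^'n \<Rightarrow> complex^'m"
  assumes f: "holomorphic_map_on f S" and S: "open S" and z: "z \<in> S"
  shows "complex_jacobian f z $ i $ j = deriv (\<lambda>w. f (z + w *s axis j 1) $ i) 0"
proof -
  define G where "G = (\<lambda>w. f (z + w *s axis j 1) $ i)"
  define U where "U = (\<lambda>w. z + w *s axis j 1) -` S"
  have U: "open U"
    unfolding U_def using S
    by (intro open_vimage continuous_intros bounded_linear.continuous_on[OF bounded_linear_vector_scalar_mult_left])
  have "G holomorphic_on U"
    unfolding G_def using holomorphic_map_on_line[OF f S U, of z "axis j 1" i] by (auto simp: U_def)
  moreover have "0 \<in> U" using z by (simp add: U_def)
  ultimately have "(G has_field_derivative deriv G 0) (at 0)"
    using holomorphic_derivI[OF _ U] by blast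
  then have "((\<lambda>w. G (w + (- (z $ j)))) has_field_derivative deriv G 0) (at (z $ j))"
    using DERIV_shift[of G "deriv G 0" "z $ j" "- (z $ j)"] by simp
  moreover have "(\<lambda>w. G (w + (- (z $ j)))) = (\<lambda>w. f (\<chi> k. if k = j then w else z $ k) $ i)"
  proof
    fix w
    have "z + (w + (- (z $ j))) *s axis j 1 = (\<chi> k. if k = j then w else z $ k)"
      by (auto simp: vec_eq_iff axis_def)
    then show "G (w + (- (z $ j))) = f (\<chi> k. if k = j then w else z $ k) $ i"
      by (simp add: G_def)
  qed
  ultimately show ?thesis
    by (simp add: complex_jacobian_def G_def DERIV_imp_deriv)
qed

lemma holomorphic_on_det_jacobian_line:
  fixes f :: "complex^'n \<Rightarrow> complex^'n"
  assumes f: "holomorphic_map_on f S" and S: "open S" and U: "open U"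
    and line: "\<And>\<zeta>. \<zeta> \<in> U \<Longrightarrow> \<zeta> *s u \<in> S"
  shows "(\<lambda>\<zeta>. det (complex_jacobian f (\<zeta> *s u))) holomorphic_on U"
proof -
  have "(\<lambda>\<zeta>. complex_jacobian f (\<zeta> *s u) $ i $ j) holomorphic_on U" for i j
    using holomorphic_on_partial_deriv_line[OF f S U line, where e = "axis j 1" and i = i]
    by (rule holomorphic_transform) (simp_all add: complex_jacobian_eq_deriv[OF f S] line)
  then show ?thesis unfolding det_def by (intro holomorphic_intros) auto
qed

lemma bloch_seminorm_le_1_iff:
  fixes f :: "complex^'n \<Rightarrow> complex^'n"
  shows "bloch_seminorm \<alpha> f \<le> 1 \<longleftrightarrow>
    (\<forall>z\<in>ball 0 1. (1 - (norm z)\<^sup>2) powr (\<alpha> * (real CARD('n) + 1) / 2) * cmod (det (complex_jacobian f z)) \<le> 1)"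
proof -
  define n where "n = real CARD('n)"
  have n: "0 < n" by (simp add: n_def)
  have "x powr (\<alpha> * (n + 1) / (2 * n)) * y powr (1 / n) = (x powr (\<alpha> * (n + 1) / 2) * y) powr (1 / n)" for x y
    using n by (simp add: powr_mult powr_powr)
  moreover have "t powr (1 / n) \<le> 1 \<longleftrightarrow> t \<le> 1" if "0 \<le> t" for t
    using powr_mono2[of "1 / n" t 1] powr_less_mono2[of "1 / n" 1 t] n that
    by (cases "t \<le> 1") (auto simp: not_le)
  ultimately show ?thesis
    unfolding bloch_seminorm_def n_def[symmetric] by (simp add: SUP_le_iff one_ereal_def)
qed

lemma bloch_seminorm_eq_1I:
  fixes f :: "complex^'n \<Rightarrow> complex^'n"
  assumes "bloch_seminorm \<alpha> f \<le> 1" and z: "norm z < 1"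
    and "(1 - (norm z)\<^sup>2) powr (\<alpha> * (real CARD('n) + 1) / 2) * cmod (det (complex_jacobian f z)) = 1"
  shows "bloch_seminorm \<alpha> f = 1"
proof (rule antisym)
  define n where "n = real CARD('n)"
  have n: "0 < n" by (simp add: n_def)
  have "(1 - (norm z)\<^sup>2) powr (\<alpha> * (n + 1) / (2 * n)) * cmod (det (complex_jacobian f z)) powr (1 / n)
      = ((1 - (norm z)\<^sup>2) powr (\<alpha> * (n + 1) / 2) * cmod (det (complex_jacobian f z))) powr (1 / n)"
    using n by (simp add: powr_mult powr_powr)
  also have "\<dots> = 1" using assms(3) by (simp add: n_def)
  finally have *: "(1 - (norm z)\<^sup>2) powr (\<alpha> * (n + 1) / (2 * n)) * cmod (det (complex_jacobian f z)) powr (1 / n) = 1" .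
  show "1 \<le> bloch_seminorm \<alpha> f"
    unfolding bloch_seminorm_def n_def[symmetric]
    by (rule SUP_upper2[of z]) (use z * in \<open>auto simp: one_ereal_def\<close>)
qed (fact assms)

section \<open>The distortion theorem in the unit ball\<close>

context
  fixes b a :: real
  assumes b: "0 < b" and a: "a = 1 / sqrt (b + 1)"
begin

lemma ball_distortion:
  fixes f :: "complex^'n \<Rightarrow> complex^'n" and m :: real
  assumes f: "holomorphic_map_on f (ball 0 1)"
    and bd: "\<And>z. norm z < 1 \<Longrightarrow> (1 - (norm z)\<^sup>2) powr (b / 2) * cmod (det (complex_jacobian f z)) \<le> 1"
    and m: "0 < m" "m \<le> a" "det (complex_jacobian f 0) = of_real (disc_phi b m)"
  shows "norm z \<le> (a + m) / (1 + a * m) \<Longrightarrow>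
      disc_phi b m * (m - norm z) / (m * (1 - m * norm z) powr (b + 1)) \<le> Re (det (complex_jacobian f z))"
    and "norm z \<le> (a - m) / (1 - a * m) \<Longrightarrow>
      cmod (det (complex_jacobian f z)) \<le> disc_phi b m * (m + norm z) / (m * (1 + m * norm z) powr (b + 1))"
proof -
  have a1: "0 < a" "a < 1" using crit_point_bounds[OF b a] by auto
  have am: "0 < a * m" "a * m < 1" using a1 m mult_strict_mono[of a 1 m 1] by auto
  obtain u where u: "norm u = 1" "z = of_real (norm z) *s u"
  proof (cases "z = 0")
    case True
    then show ?thesis using that[of "axis undefined 1"] by simp
  next
    case False
    show ?thesis
    proof (rule that)
      show "norm (of_real (1 / norm z) *s z) = 1"
        unfolding norm_vector_scalar_mult norm_of_real using False by simp
      show "z = of_real (norm z) *s (of_real (1 / norm z) *s z)"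
        using False by (simp add: vector_smult_assoc)
    qed
  qed
  define g where "g v \<zeta> = det (complex_jacobian f (\<zeta> *s v))" for v \<zeta>
  have g: "g v holomorphic_on ball 0 1" if "norm v = 1" for v
    unfolding g_def using that
    by (intro holomorphic_on_det_jacobian_line[OF f]) (auto simp: norm_vector_scalar_mult)
  have gb: "(1 - (cmod \<zeta>)\<^sup>2) powr (b / 2) * cmod (g v \<zeta>) \<le> 1" if "norm v = 1" "cmod \<zeta> < 1" for v \<zeta>
    using bd[of "\<zeta> *s v"] that by (simp add: g_def norm_vector_scalar_mult)
  have g0: "g v 0 = of_real (disc_phi b m)" for v using m by (simp add: g_def)
  let ?r = "norm z"
  show "disc_phi b m * (m - ?r) / (m * (1 - m * ?r) powr (b + 1)) \<le> Re (det (complex_jacobian f z))"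
    if r: "?r \<le> (a + m) / (1 + a * m)"
  proof -
    have "0 < (1 - a) * (1 - m)" using a1 m by simp
    then have "(a + m) / (1 + a * m) < 1" using am by (simp add: field_simps)
    then have 1: "\<bar>?r\<bar> < 1" using r by simp
    have 2: "?r - m \<le> a * (1 - m * ?r)" using r am by (simp add: field_simps)
    have "m - a \<le> ?r * (1 - a * m)" using m am by (smt (verit) mult_nonneg_nonneg norm_ge_zero)
    then have "m - ?r \<le> a * (1 - m * ?r)" by (simp add: algebra_simps)
    with 2 have 3: "\<bar>m - ?r\<bar> \<le> a * (1 - m * ?r)" by simp
    show ?thesis
      using disc_distortion(1)[OF b a g[OF u(1)] gb[OF u(1)] m(1,2) g0 1 3] u(2) by (simp add: g_def)
  qed
  show "cmod (det (complex_jacobian f z)) \<le> disc_phi b m * (m + ?r) / (m * (1 + m * ?r) powr (b + 1))"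
    if r: "?r \<le> (a - m) / (1 - a * m)"
  proof -
    have "0 < (1 - a) * (1 + m)" using a1 m by simp
    then have "(a - m) / (1 - a * m) < 1" using am by (simp add: field_simps)
    then have 1: "\<bar>- ?r\<bar> < 1" using r by simp
    have 2: "m + ?r \<le> a * (1 + m * ?r)" using r am by (simp add: field_simps)
    then have 3: "\<bar>m - - ?r\<bar> \<le> a * (1 - m * - ?r)" using m(1) by simp
    have u': "norm (- u) = 1" using u by simp
    have "of_real (- ?r) *s (- u) = z" using u(2) by (simp add: vec_eq_iff)
    then show ?thesis
      using disc_distortion(2)[OF b a g[OF u'] gb[OF u'] m(1,2) g0 1 3] by (simp add: g_def)
  qed
qed

definition disc_extremal :: "real \<Rightarrow> complex \<Rightarrow> complex" where
  "disc_extremal m \<zeta> = of_real (disc_phi b m / m) * (of_real m - \<zeta>) *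
     exp (- of_real (b + 1) * Ln (1 - of_real m * \<zeta>))"

lemma holomorphic_disc_extremal:
  assumes m: "0 < m" "m < 1"
  shows "disc_extremal m holomorphic_on ball 0 1"
  unfolding disc_extremal_def
proof (intro holomorphic_intros)
  fix w :: complex assume "w \<in> ball 0 1"
  then have "cmod (of_real m * w) < 1"
    using m mult_strict_mono[of m 1 "cmod w" 1] by (simp add: norm_mult)
  then have "0 < Re (1 - of_real m * w)" using complex_Re_le_cmod[of "of_real m * w"] by simp
  then show "1 - of_real m * w \<notin> \<real>\<^sub>\<le>\<^sub>0" by (auto simp: complex_nonpos_Reals_iff)
qed

lemma disc_extremal_of_real:
  assumes "m * x < 1"
  shows "disc_extremal m (of_real x) = of_real (disc_phi b m * (m - x) / (m * (1 - m * x) powr (b + 1)))"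
proof -
  have 1: "1 - of_real m * of_real x = complex_of_real (1 - m * x)" by simp
  show ?thesis
    unfolding disc_extremal_def 1 using assms
    by (subst exp_mult_Ln_of_real) (simp_all only: powr_minus_divide diff_gt_0_iff_gt, simp)
qed

lemma norm_disc_extremal:
  assumes m: "0 < m" "m < 1" and z: "cmod \<zeta> < 1"
  shows "(1 - (cmod \<zeta>)\<^sup>2) powr (b / 2) * cmod (disc_extremal m \<zeta>) = disc_phi b (cmod (disc_inv m \<zeta>))"
proof -
  have m1: "\<bar>m\<bar> < 1" using m by simp
  define D where "D = cmod (1 - of_real m * \<zeta>)"
  have nz: "1 - of_real m * \<zeta> \<noteq> 0" using disc_inv_denom_nz[OF m1, of \<zeta>] z by simp
  then have D: "0 < D" by (simp add: D_def)
  have pos: "0 < 1 - m\<^sup>2" "0 < 1 - (cmod \<zeta>)\<^sup>2"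
    using m1 z abs_square_less_1[of m] abs_square_less_1[of "cmod \<zeta>"] by auto
  have "(D\<^sup>2) powr (b / 2) = D powr b"
    using D by (simp add: powr_powr flip: powr_numeral)
  then have 1: "(1 - (cmod (disc_inv m \<zeta>))\<^sup>2) powr (b / 2)
      = (1 - m\<^sup>2) powr (b / 2) * (1 - (cmod \<zeta>)\<^sup>2) powr (b / 2) / D powr b"
    using one_minus_norm_disc_inv[OF m1, of \<zeta>] z pos
    by (simp add: D_def[symmetric] powr_divide powr_mult)
  have 2: "cmod (disc_inv m \<zeta>) = cmod (of_real m - \<zeta>) / D"
    by (simp add: disc_inv_def norm_divide D_def)
  have 3: "cmod (exp (- of_real (b + 1) * Ln (1 - of_real m * \<zeta>))) = 1 / (D powr b * D)"
    using D unfolding norm_exp_mult_Ln[OF nz] D_def[symmetric]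
    by (simp only: powr_minus_divide powr_add) simp
  have "0 \<le> disc_phi b m / m" using m pos b by (simp add: disc_phi_def)
  then have 4: "cmod (of_real (disc_phi b m / m)) = disc_phi b m / m"
    unfolding norm_of_real by (rule abs_of_nonneg)
  have 5: "disc_phi b m / m = (1 - m\<^sup>2) powr (b / 2) * sqrt (b + 1) * ((b + 1) / b) powr (b / 2)"
    using m by (simp add: disc_phi_def)
  show ?thesis
    unfolding disc_extremal_def norm_mult 3 4 disc_phi_def[of _ "cmod (disc_inv m \<zeta>)"] 1
    unfolding 2 5 by (simp add: mult_ac)
qed

lemma ball_extremal_exists:
  assumes m: "0 < m" "m \<le> a"
  obtains f :: "complex^'n \<Rightarrow> complex^'n" and i where
    "holomorphic_map_on f (ball 0 1)"
    "\<And>z. norm z < 1 \<Longrightarrow> det (complex_jacobian f z) = disc_extremal m (z $ i)"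
proof -
  have m1: "0 < m" "m < 1" using m crit_point_bounds[OF b a] by auto
  obtain P where P: "\<And>x. x \<in> ball 0 1 \<Longrightarrow> (P has_field_derivative disc_extremal m x) (at x within ball 0 1)"
    using holomorphic_convex_primitive'[OF convex_ball open_ball holomorphic_disc_extremal[OF m1]] by metis
  then have P: "(P has_field_derivative disc_extremal m x) (at x)" if "x \<in> ball 0 1" for x
    using that by (metis at_within_open open_ball)
  define i :: 'n where "i = undefined"
  define f :: "complex^'n \<Rightarrow> complex^'n" where "f z = (\<chi> k. if k = i then P (z $ i) else z $ k)" for z
  have f_alt: "f = (\<lambda>z. z + (P (z $ i) - z $ i) *s axis i 1)"
    by (auto simp: fun_eq_iff vec_eq_iff f_def axis_def)
  have zi: "z $ i \<in> ball 0 1" if "norm z < 1" for z :: "complex^'n"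
    using that Finite_Cartesian_Product.norm_nth_le[of z i] by simp
  show ?thesis
  proof (rule that[of f i])
    show "holomorphic_map_on f (ball 0 1)"
      unfolding holomorphic_map_on_def
    proof
      fix z :: "complex^'n" assume "z \<in> ball 0 1"
      then have "(P has_derivative (*) (disc_extremal m (z $ i))) (at (z $ i))"
        using P[OF zi] by (simp add: has_field_derivative_def)
      from has_derivative_compose[OF bounded_linear.has_derivative[OF bounded_linear_vec_nth has_derivative_ident] this]
      have "((\<lambda>z. P (z $ i)) has_derivative (\<lambda>h. disc_extremal m (z $ i) * h $ i)) (at z)" by simp
      from has_derivative_add[OF has_derivative_ident
          bounded_linear.has_derivative[OF bounded_linear_vector_scalar_mult_left
            has_derivative_diff[OF this bounded_linear.has_derivative[OF bounded_linear_vec_nth has_derivative_ident]]]]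
      have "(f has_derivative (\<lambda>h. h + (disc_extremal m (z $ i) * h $ i - h $ i) *s axis i 1)) (at z)"
        unfolding f_alt .
      then show "\<exists>D. (f has_derivative D) (at z within ball 0 1) \<and> (\<forall>c v. D (c *s v) = c *s D v)"
        by (intro exI[of _ "\<lambda>h. h + (disc_extremal m (z $ i) * h $ i - h $ i) *s axis i 1"])
          (auto simp: has_derivative_at_withinI vec_eq_iff algebra_simps)
    qed
    fix z :: "complex^'n" assume z: "norm z < 1"
    have "complex_jacobian f z $ k $ j = (if k = j then if k = i then disc_extremal m (z $ i) else 1 else 0)" for k j
      using DERIV_imp_deriv[OF P[OF zi[OF z]]]
      by (cases "k = i"; cases "j = k") (auto simp: complex_jacobian_def f_def)
    then show "det (complex_jacobian f z) = disc_extremal m (z $ i)"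
      by (subst det_diagonal) auto
  qed
qed

end

theorem theorem1p2:
  fixes \<alpha> lam :: real
  assumes "\<alpha> > 0" and "0 < lam" and "lam \<le> 1"
  shows "let n = CARD('n::finite);
             a\<^sub>0 = bloch_a0 \<alpha> n;
             m = bloch_m \<alpha> n lam;
             J = (\<lambda>(f :: complex^'n \<Rightarrow> complex^'n) z. det (complex_jacobian f z));
             R = (a\<^sub>0 + m) / (1 + a\<^sub>0 * m);
             R' = (a\<^sub>0 - m) / (1 - a\<^sub>0 * m);
             lower = (\<lambda>r. lam * (m - r) / (m * (1 - m * r) powr (\<alpha> * (real n + 1) + 1)));
             upper = (\<lambda>r. lam * (m + r) / (m * (1 + m * r) powr (\<alpha> * (real n + 1) + 1)))
         in
           (\<exists>!x. x \<in> {0..a\<^sub>0} \<and> bloch_phi \<alpha> n x = lam) \<and>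
           (\<forall>f \<in> bloch_class \<alpha> lam.
              (\<forall>z. norm z \<le> R \<longrightarrow> cmod (J f z) \<ge> Re (J f z) \<and> Re (J f z) \<ge> lower (norm z)) \<and>
              (\<forall>z. norm z \<le> R' \<longrightarrow> cmod (J f z) \<le> upper (norm z))) \<and>
           (\<exists>f \<in> bloch_class \<alpha> lam. \<forall>r \<in> {0..R}. \<exists>z. norm z = r \<and>
              Re (J f z) = lower r \<and> (r \<le> m \<longrightarrow> cmod (J f z) = Re (J f z))) \<and>
           (\<exists>f \<in> bloch_class \<alpha> lam. \<forall>r \<in> {0..R'}. \<exists>z. norm z = r \<and> cmod (J f z) = upper r)"
proof -
  define b where "b = \<alpha> * (real CARD('n) + 1)"
  define a where "a = bloch_a0 \<alpha> CARD('n)"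
  define m where "m = bloch_m \<alpha> CARD('n) lam"
  have b: "0 < b" using assms(1) by (simp add: b_def add_pos_pos)
  have a: "a = 1 / sqrt (b + 1)" by (simp add: a_def bloch_a0_def b_def)
  have phi: "bloch_phi \<alpha> CARD('n) = disc_phi b" by (simp add: bloch_phi_eq_disc_phi b_def)
  have ex1: "\<exists>!x. x \<in> {0..a} \<and> disc_phi b x = lam" using disc_phi_ex1[OF b a] assms by blast
  have m: "m \<in> {0..a} \<and> disc_phi b m = lam"
    unfolding m_def bloch_m_def phi a_def[symmetric] by (rule theI'[OF ex1])
  then have m0: "0 < m" using assms by (cases "m = 0") (auto simp: disc_phi_def)
  have m: "0 < m" "m \<le> a" "disc_phi b m = lam" using m m0 by auto
  have a1: "0 < a" "a < 1" using crit_point_bounds[OF b a] by auto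
  have m1: "m < 1" using m a1 by simp
  have am: "0 < a * m" "a * m < 1" using a1 m mult_strict_mono[of a 1 m 1] by auto
  have R: "(a + m) / (1 + a * m) < 1" "(a - m) / (1 - a * m) < 1"
  proof -
    have "0 < (1 - a) * (1 - m)" "0 < (1 - a) * (1 + m)" using a1 m m1 by auto
    then show "(a + m) / (1 + a * m) < 1" "(a - m) / (1 - a * m) < 1"
      using am by (auto simp: field_simps)
  qed
  obtain f0 :: "complex^'n \<Rightarrow> complex^'n" and i where f0: "holomorphic_map_on f0 (ball 0 1)"
    "\<And>z. norm z < 1 \<Longrightarrow> det (complex_jacobian f0 z) = disc_extremal b m (z $ i)"
    using ball_extremal_exists[OF b a m(1,2)] by metis
  have f0_axis: "det (complex_jacobian f0 (axis i (of_real x)))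
      = of_real (lam * (m - x) / (m * (1 - m * x) powr (b + 1)))" if x: "\<bar>x\<bar> < 1" for x
  proof -
    have "m * x \<le> m * 1" using m x by (intro mult_left_mono) auto
    then have "m * x < 1" using m1 by simp
    then show ?thesis
      using f0(2)[of "axis i (of_real x)"] x disc_extremal_of_real[OF b a, of m x] m by (simp add: norm_axis)
  qed
  have f0_class: "f0 \<in> bloch_class \<alpha> lam"
  proof -
    have le: "bloch_seminorm \<alpha> f0 \<le> 1"
      unfolding bloch_seminorm_le_1_iff b_def[symmetric]
    proof
      fix z :: "complex^'n" assume "z \<in> ball 0 1"
      then have z: "norm z < 1" by simp
      then have zi: "cmod (z $ i) < 1" using Finite_Cartesian_Product.norm_nth_le[of z i] by simp
      have "(1 - (norm z)\<^sup>2) powr (b / 2) \<le> (1 - (cmod (z $ i))\<^sup>2) powr (b / 2)"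
        using z b Finite_Cartesian_Product.norm_nth_le[of z i]
        by (intro powr_mono2) (auto intro: power_mono simp: power_le_one)
      then have "(1 - (norm z)\<^sup>2) powr (b / 2) * cmod (disc_extremal b m (z $ i))
          \<le> (1 - (cmod (z $ i))\<^sup>2) powr (b / 2) * cmod (disc_extremal b m (z $ i))"
        by (rule mult_right_mono) simp
      also have "\<dots> = disc_phi b (cmod (disc_inv m (z $ i)))"
        using norm_disc_extremal[OF b a m(1) m1 zi] .
      also have "\<dots> \<le> 1"
        using disc_phi_le_1[OF b a] norm_disc_inv_less[of m "z $ i"] m m1 zi by simp
      finally show "(1 - (norm z)\<^sup>2) powr (b / 2) * cmod (det (complex_jacobian f0 z)) \<le> 1"
        using f0(2)[OF z] by simp
    qed
    define \<zeta> where "\<zeta> = disc_inv m (of_real a)"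
    have \<zeta>: "cmod \<zeta> < 1" "disc_inv m \<zeta> = of_real a"
      unfolding \<zeta>_def using a1 m m1 by (simp_all add: norm_disc_inv_less disc_inv_disc_inv)
    have "bloch_seminorm \<alpha> f0 = 1"
    proof (rule bloch_seminorm_eq_1I[OF le])
      show "norm (axis i \<zeta> :: complex^'n) < 1" using \<zeta> by (simp add: norm_axis)
      show "(1 - (norm (axis i \<zeta> :: complex^'n))\<^sup>2) powr (\<alpha> * (real CARD('n) + 1) / 2)
          * cmod (det (complex_jacobian f0 (axis i \<zeta>))) = 1"
        using norm_disc_extremal[OF b a m(1) m1 \<zeta>(1)] f0(2)[of "axis i \<zeta>"] \<zeta> a1 disc_phi_crit_point[OF b a]
        by (simp add: b_def[symmetric] norm_axis)
    qed
    moreover have "det (complex_jacobian f0 0) = of_real lam"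
    proof -
      have axis_0: "axis i (0 :: complex) = (0 :: complex^'n)" by simp
      show ?thesis using f0_axis[of 0] m(1) by (simp add: axis_0)
    qed
    ultimately show ?thesis using f0 by (simp add: bloch_class_def)
  qed
  have dist: "holomorphic_map_on f (ball 0 1)"
      "norm z < 1 \<Longrightarrow> (1 - (norm z)\<^sup>2) powr (b / 2) * cmod (det (complex_jacobian f z)) \<le> 1"
      "det (complex_jacobian f 0) = of_real (disc_phi b m)"
    if "f \<in> bloch_class \<alpha> lam" for f :: "complex^'n \<Rightarrow> complex^'n" and z
    using that bloch_seminorm_le_1_iff[of \<alpha> f] m(3) by (auto simp: bloch_class_def b_def)
  note D = ball_distortion[OF b a dist(1,2) m(1,2) dist(3), unfolded m(3)]
  show ?thesis
    unfolding Let_def a_def[symmetric] m_def[symmetric] phi b_def[symmetric]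
  proof (intro conjI ballI allI impI)
    show "\<exists>!x. x \<in> {0..a} \<and> disc_phi b x = lam" by (fact ex1)
    show "\<exists>f\<in>bloch_class \<alpha> lam. \<forall>r\<in>{0..(a + m) / (1 + a * m)}. \<exists>z::complex^'n. norm z = r \<and>
        Re (det (complex_jacobian f z)) = lam * (m - r) / (m * (1 - m * r) powr (b + 1)) \<and>
        (r \<le> m \<longrightarrow> cmod (det (complex_jacobian f z)) = Re (det (complex_jacobian f z)))"
    proof (intro bexI[of _ f0] ballI f0_class)
      fix r assume r: "r \<in> {0..(a + m) / (1 + a * m)}"
      then have r1: "\<bar>r\<bar> < 1" using R by auto
      have nonneg: "0 \<le> lam * (m - r) / (m * (1 - m * r) powr (b + 1))" if "r \<le> m"
        using that m assms by simp
      show "\<exists>z::complex^'n. norm z = r \<and>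
          Re (det (complex_jacobian f0 z)) = lam * (m - r) / (m * (1 - m * r) powr (b + 1)) \<and>
          (r \<le> m \<longrightarrow> cmod (det (complex_jacobian f0 z)) = Re (det (complex_jacobian f0 z)))"
      proof (intro exI[of _ "axis i (of_real r)"] conjI impI)
        show "norm (axis i (of_real r) :: complex^'n) = r" using r by (simp add: norm_axis)
      qed (simp_all only: f0_axis[OF r1] norm_of_real Re_complex_of_real abs_of_nonneg[OF nonneg])
    qed
    show "\<exists>f\<in>bloch_class \<alpha> lam. \<forall>r\<in>{0..(a - m) / (1 - a * m)}. \<exists>z::complex^'n. norm z = r \<and>
        cmod (det (complex_jacobian f z)) = lam * (m + r) / (m * (1 + m * r) powr (b + 1))"
    proof (intro bexI[of _ f0] ballI f0_class)
      fix r assume r: "r \<in> {0..(a - m) / (1 - a * m)}"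
      then have r1: "\<bar>- r\<bar> < 1" using R by auto
      have nonneg: "0 \<le> lam * (m + r) / (m * (1 + m * r) powr (b + 1))"
        using m assms r by simp
      show "\<exists>z::complex^'n. norm z = r \<and>
          cmod (det (complex_jacobian f0 z)) = lam * (m + r) / (m * (1 + m * r) powr (b + 1))"
      proof (intro exI[of _ "axis i (of_real (- r))"] conjI)
        show "norm (axis i (of_real (- r)) :: complex^'n) = r" using r by (simp add: norm_axis)
      qed (simp only: f0_axis[OF r1] norm_of_real mult_minus_right diff_minus_eq_add abs_of_nonneg[OF nonneg])
    qed
  qed (use D complex_Re_le_cmod in auto)
qed

end
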